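(* Fix an issue time $\tau_n$, and let $\mathcal F_{\tau_n}$ be the sub-sigma-algebra of information available at $\tau_n$. If the timetable or confirmed train counts, the route and rolling-stock parameters, and the hourly targets used in the synthesis construction (Steps 1--6 of the context) are all $\mathcal F_{\tau_n}$-measurable, and no realized measurement later than $\tau_n$ is used, then the synthesized quarter-hour profiles are $\mathcal F_{\tau_n}$-measurable.
   Context: On a probability space $(\Omega_0,\mathcal F,\mathbb P_0)$, $\mathcal F_{\tau_n}\subseteq\mathcal F$ is a sub-sigma-algebra; the paper calls a quantity $\mathcal F_{\tau_n}$-measurable if it is determined by the information available at $\tau_n$ (measurements, confirmed schedules, issued forecasts, active day-ahead decisions, and physical states available by $\tau_n$). Synthesis construction. Step 1 (train runs). For each of finitely many train runs $\varrho$: a stop sequence $s_1,\dots,s_{n_\varrho}$, issued absolute arrival/departure times, a traffic category, a mass $m^{\mathrm{tr}}_\varrho$; on leg $k$ a booked running time $T_{\varrho,k}$ and a route length $d_{\varrho,k}$. Longitudinal dynamics: $\lambda^{\mathrm{rot}}_\varrho m^{\mathrm{tr}}_\varrho\dot v_\varrho=F^{\mathrm{trac}}_\varrho-(A_\varrho+B_\varrho v_\varrho+C_\varrho v_\varrho^2)-m^{\mathrm{tr}}_\varrho g\sin\gamma$, with rotating-mass factor $\lambda^{\mathrm{rot}}_\varrho>0$, resistance coefficients $A_\varrho,B_\varrho,C_\varrho$, and gradient $\gamma$. The speed profile on each leg is trapezoidal: accelerate at $a^+>0$, cruise at $v^{\mathrm{cr}}$, brake at $a^-<0$, with $\kappa_v=\tfrac12(1/a^++1/|a^-|)$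 and $v^{\mathrm{cr}}=(T_{\varrho,k}-\sqrt{T_{\varrho,k}^2-4\kappa_vd_{\varrho,k}})/(2\kappa_v)$ if $T_{\varrho,k}^2\ge4\kappa_vd_{\varrho,k}$; otherwise a triangular profile with peak speed $\sqrt{d_{\varrho,k}/\kappa_v}$ and relaxed running time may be used. The dynamics determine $F^{\mathrm{trac}}_\varrho(\vartheta)$. Step 2 (power). $P^{\mathrm{mech}}_\varrho=F^{\mathrm{trac}}_\varrho v_\varrho$; with drivetrain efficiency $\eta_{\mathrm d}$, regenerative fraction $\eta_{\mathrm{rb}}$, auxiliary power $P^{\mathrm{aux}}_\varrho$: $p^{\mathrm{el}}_\varrho=P^{\mathrm{mech}}_\varrho/\eta_{\mathrm d}+P^{\mathrm{aux}}_\varrho$ if $P^{\mathrm{mech}}_\varrho\ge0$ and $p^{\mathrm{el}}_\varrho=\eta_{\mathrm d}\eta_{\mathrm{rb}}P^{\mathrm{mech}}_\varrho+P^{\mathrm{aux}}_\varrho$ otherwise; $\pi^{\mathrm{mot}}_\varrho=\max\{p^{\mathrm{el}}_\varrho,0\}$, $\pi^{\mathrm{av}}_\varrho=\max\{-p^{\mathrm{el}}_\varrho,0\}$. Step 3 (area assignment and binning). With $\Delta_{\mathrm{ID}}=\tfrac14$ h, $\Delta_{\mathrm{DA}}=1$ h, $\nu=4$, quarter-hour bins $\mathcal B_{h,k}=[\tau_0^{\mathrm{DA}}+h\Delta_{\mathrm{DA}}+k\Delta_{\mathrm{ID}},\tau_0^{\mathrm{DA}}+h\Delta_{\mathrm{DA}}+(k+1)\Delta_{\mathrm{ID}})$,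 train position $x_\varrho(\vartheta)$, and a map $\chi$ from track positions to control areas, for $q\in\{\mathrm{mot},\mathrm{av}\}$: $\widetilde P^q_{i,h,k}=\frac1{\Delta_{\mathrm{ID}}}\sum_\varrho\int_{\mathcal B_{h,k}}\mathbf 1\{\chi(x_\varrho(\vartheta))=i\}\pi^q_\varrho(\vartheta)\,\mathrm d\vartheta$. (If complete train paths are unavailable, the same formulas are evaluated with confirmed category counts, representative train-leg profiles, and clock-face arrival and departure templates.) Step 4 (normalization). $\widehat w^q_{i,h,k}=\widetilde P^q_{i,h,k}/\sum_{j=0}^{\nu-1}\widetilde P^q_{i,h,j}$ if the denominator is positive, and $1/\nu$ otherwise. Step 5 (concentration). For the parameter $c\in[0,1]$ and hourly mean targets $\overline P^q_i(h)$: $w^q_{i,h,k}(c)=\frac{1-c}\nu+c\,\widehat w^q_{i,h,k}$ and the synthesized profile is $P^q_{i,h,k}(c)=\nu\,\overline P^q_i(h)\,w^q_{i,h,k}(c)$. Step 6 (alternative projection). Alternatively, the synthesized profile is the unique minimizer over $P^q_{i,h,k}\ge0$ of $\sum_{k=0}^{\nu-1}a^q_{i,h,k}(P^q_{i,h,k}-\widetilde P^q_{i,h,k})^2+\varsigma\sum_{k=0}^{\nu-2}(P^q_{i,h,k+1}-P^q_{i,h,k})^2$ subject to $\frac1\nu\sum_{k=0}^{\nu-1}P^q_{i,h,k}=\overline P^q_i(h)$, with $a^q_{i,h,k}>0$ and $\varsigma\ge0$. *)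

theory Defs
  imports "HOL-Probability.Probability"
begin

text \<open>
  All quantities are in one coherent unit system whose time unit is the hour; times are absolute
  real numbers.
\<close>

definition dt_ID :: real where "dt_ID = 1 / 4"
definition dt_DA :: real where "dt_DA = 1"
definition nu :: nat where "nu = 4"

datatype power_kind = Mot | Av

text \<open>
  A run with \<open>n_stops\<close> stops, numbered from 0, has legs \<open>k < n_stops - 1\<close>, leg \<open>k\<close> going from stop
  \<open>k\<close> to stop \<open>Suc k\<close>.  The type \<open>'p\<close> is that of track positions: \<open>leg_path k s\<close> is the track position
  at distance \<open>s\<close> from the beginning of leg \<open>k\<close>, and \<open>leg_gradient k s\<close> is the gradient angle there.
  The braking acceleration \<open>brake\<close> is signed (negative).  The auxiliary power is a function of
  absolute time.
\<close>

record ('p, 'c) train_run =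
  n_stops :: nat
  stop_at :: "nat \<Rightarrow> 'p"
  arrival :: "nat \<Rightarrow> real"
  departure :: "nat \<Rightarrow> real"
  category :: 'c
  mass :: real
  leg_length :: "nat \<Rightarrow> real"
  leg_path :: "nat \<Rightarrow> real \<Rightarrow> 'p"
  leg_gradient :: "nat \<Rightarrow> real \<Rightarrow> real"
  rot_factor :: real
  res_const :: real
  res_lin :: real
  res_quad :: real
  accel :: real
  brake :: real
  eta_drive :: real
  eta_regen :: real
  aux_power :: "real \<Rightarrow> real"

definition n_legs :: "('p, 'c) train_run \<Rightarrow> nat" where
  "n_legs R = n_stops R - 1"

definition run_wf :: "('p, 'c) train_run \<Rightarrow> bool" where
  "run_wf R \<longleftrightarrow> 0 < rot_factor R \<and> 0 < accel R \<and> brake R < 0"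


subsection \<open>Longitudinal dynamics\<close>

definition kappa_v :: "('p, 'c) train_run \<Rightarrow> real" where
  "kappa_v R = (1 / accel R + 1 / \<bar>brake R\<bar>) / 2"

definition booked_time :: "('p, 'c) train_run \<Rightarrow> nat \<Rightarrow> real" where
  "booked_time R k = arrival R (Suc k) - departure R k"

definition trapezoidal :: "('p, 'c) train_run \<Rightarrow> nat \<Rightarrow> bool" where
  "trapezoidal R k \<longleftrightarrow> (booked_time R k)\<^sup>2 \<ge> 4 * kappa_v R * leg_length R k"

text \<open>Cruising speed of the trapezoidal profile, or peak speed of the triangular one.\<close>

definition top_speed :: "('p, 'c) train_run \<Rightarrow> nat \<Rightarrow> real" where
  "top_speed R k =
    (if trapezoidal R k
     then (booked_time R k - sqrt ((booked_time R k)\<^sup>2 - 4 * kappa_v R * leg_length R k))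
            / (2 * kappa_v R)
     else sqrt (leg_length R k / kappa_v R))"

text \<open>
  The relaxed running time of the triangular profile with peak speed \<open>v\<close> is the sum of the
  acceleration time \<open>v / a\<^sup>+\<close> and the braking time \<open>v / \<bar>a\<^sup>-\<bar>\<close>, that is \<open>2 \<kappa>\<^sub>v v\<close>.
\<close>

definition running_time :: "('p, 'c) train_run \<Rightarrow> nat \<Rightarrow> real" where
  "running_time R k =
    (if trapezoidal R k then booked_time R k else 2 * kappa_v R * top_speed R k)"

text \<open>Speed and acceleration at time \<open>u\<close> after the beginning of leg \<open>k\<close>.\<close>

definition leg_speed :: "('p, 'c) train_run \<Rightarrow> nat \<Rightarrow> real \<Rightarrow> real" where
  "leg_speed R k u =
    (if u < 0 \<or> running_time R k \<le> u then 0
     else if u < top_speed R k / accel R then accel R * u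
     else if u < running_time R k - top_speed R k / \<bar>brake R\<bar> then top_speed R k
     else \<bar>brake R\<bar> * (running_time R k - u))"

definition leg_accel :: "('p, 'c) train_run \<Rightarrow> nat \<Rightarrow> real \<Rightarrow> real" where
  "leg_accel R k u =
    (if u < 0 \<or> running_time R k \<le> u then 0
     else if u < top_speed R k / accel R then accel R
     else if u < running_time R k - top_speed R k / \<bar>brake R\<bar> then 0
     else brake R)"

definition leg_distance :: "('p, 'c) train_run \<Rightarrow> nat \<Rightarrow> real \<Rightarrow> real" where
  "leg_distance R k u = (LINT t:{0..u}|lborel. leg_speed R k t)"

text \<open>
  A train leaves at the issued departure time, or later if a relaxed running time on a previous leg
  makes it arrive after that time.
\<close>

primrec leg_start :: "('p, 'c) train_run \<Rightarrow> nat \<Rightarrow> real" where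
  "leg_start R 0 = departure R 0"
| "leg_start R (Suc k) = max (departure R (Suc k)) (leg_start R k + running_time R k)"

text \<open>
  A run is in service from its first departure until its last arrival, including the dwell times at
  the intermediate stops; outside this period it contributes no power.
\<close>

definition in_service :: "('p, 'c) train_run \<Rightarrow> real \<Rightarrow> bool" where
  "in_service R t \<longleftrightarrow> 0 < n_legs R \<and> leg_start R 0 \<le> t
     \<and> t < leg_start R (n_legs R - 1) + running_time R (n_legs R - 1)"

text \<open>
  For a run in service at time \<open>t\<close>: the last leg begun by \<open>t\<close> (the train is under way on it or
  dwells at its end), and the time since its beginning.
\<close>

definition current_leg :: "('p, 'c) train_run \<Rightarrow> real \<Rightarrow> nat" where
  "current_leg R t = (GREATEST k. k < n_legs R \<and> leg_start R k \<le> t)"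

definition leg_time :: "('p, 'c) train_run \<Rightarrow> real \<Rightarrow> real" where
  "leg_time R t = t - leg_start R (current_leg R t)"

definition speed :: "('p, 'c) train_run \<Rightarrow> real \<Rightarrow> real" where
  "speed R t = leg_speed R (current_leg R t) (leg_time R t)"

definition acceleration :: "('p, 'c) train_run \<Rightarrow> real \<Rightarrow> real" where
  "acceleration R t = leg_accel R (current_leg R t) (leg_time R t)"

definition gradient :: "('p, 'c) train_run \<Rightarrow> real \<Rightarrow> real" where
  "gradient R t =
    leg_gradient R (current_leg R t) (leg_distance R (current_leg R t) (leg_time R t))"

definition position :: "('p, 'c) train_run \<Rightarrow> real \<Rightarrow> 'p" where
  "position R t =
    (if leg_time R t < running_time R (current_leg R t)
     then leg_path R (current_leg R t) (leg_distance R (current_leg R t) (leg_time R t))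
     else stop_at R (Suc (current_leg R t)))"

text \<open>The equation of motion solved for the tractive force; \<open>g\<close> is the gravitational acceleration.\<close>

definition traction :: "real \<Rightarrow> ('p, 'c) train_run \<Rightarrow> real \<Rightarrow> real" where
  "traction g R t =
    rot_factor R * mass R * acceleration R t
    + (res_const R + res_lin R * speed R t + res_quad R * (speed R t)\<^sup>2)
    + mass R * g * sin (gradient R t)"


subsection \<open>Power\<close>

definition mech_power :: "real \<Rightarrow> ('p, 'c) train_run \<Rightarrow> real \<Rightarrow> real" where
  "mech_power g R t = traction g R t * speed R t"

definition el_power :: "real \<Rightarrow> ('p, 'c) train_run \<Rightarrow> real \<Rightarrow> real" where
  "el_power g R t =
    (if 0 \<le> mech_power g R t
     then mech_power g R t / eta_drive R + aux_power R t
     else eta_drive R * eta_regen R * mech_power g R t + aux_power R t)"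

fun power :: "real \<Rightarrow> power_kind \<Rightarrow> ('p, 'c) train_run \<Rightarrow> real \<Rightarrow> real" where
  "power g Mot R t = max (el_power g R t) 0"
| "power g Av R t = max (- el_power g R t) 0"


subsection \<open>Area assignment and binning\<close>

text \<open>\<open>t0\<close> is the beginning of the day-ahead horizon; \<open>area\<close> maps track positions to control areas.\<close>

definition bin :: "real \<Rightarrow> nat \<Rightarrow> nat \<Rightarrow> real set" where
  "bin t0 h k =
    {t0 + real h * dt_DA + real k * dt_ID ..< t0 + real h * dt_DA + (real k + 1) * dt_ID}"

definition run_bin ::
  "real \<Rightarrow> real \<Rightarrow> ('p \<Rightarrow> 'i) \<Rightarrow> power_kind \<Rightarrow> 'i \<Rightarrow> nat \<Rightarrow> nat \<Rightarrow> ('p, 'c) train_run \<Rightarrow> real" where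
  "run_bin g t0 area q i h k R =
    (LINT t:bin t0 h k|lborel.
       (if in_service R t \<and> area (position R t) = i then power g q R t else 0))"

text \<open>
  The traffic data, as random quantities.  \<open>Timetable N R\<close> consists of the train runs
  \<open>R \<omega> r\<close> with \<open>r < N \<omega>\<close>.  In \<open>Confirmed hs n rep arr dep\<close>, used if complete train paths are
  unavailable, \<open>n \<omega> c h\<close> is the confirmed number of trains of category \<open>c\<close> in hour \<open>h\<close> (counted from
  the beginning of the horizon; trains of hours before it may still be running in it), \<open>rep \<omega> c\<close> is
  the representative profile of the category, and \<open>arr \<omega> c j k\<close>, \<open>dep \<omega> c j k\<close> are the clock-face
  templates: the times at stop \<open>k\<close> of the \<open>j\<close>-th train of an hour, relative to that hour.
\<close>

datatype ('w, 'p, 'c) traffic =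
    Timetable "'w \<Rightarrow> nat" "'w \<Rightarrow> nat \<Rightarrow> ('p, 'c) train_run"
  | Confirmed "int set" "'w \<Rightarrow> 'c \<Rightarrow> int \<Rightarrow> nat" "'w \<Rightarrow> 'c \<Rightarrow> ('p, 'c) train_run"
      "'w \<Rightarrow> 'c \<Rightarrow> nat \<Rightarrow> nat \<Rightarrow> real" "'w \<Rightarrow> 'c \<Rightarrow> nat \<Rightarrow> nat \<Rightarrow> real"

definition template_run ::
  "real \<Rightarrow> 'c \<Rightarrow> int \<Rightarrow> ('p, 'c) train_run \<Rightarrow> (nat \<Rightarrow> real) \<Rightarrow> (nat \<Rightarrow> real) \<Rightarrow> ('p, 'c) train_run" where
  "template_run t0 c h R arr dep =
    R\<lparr>category := c,
      arrival := (\<lambda>k. t0 + of_int h * dt_DA + arr k),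
      departure := (\<lambda>k. t0 + of_int h * dt_DA + dep k)\<rparr>"

text \<open>The unnormalized quarter-hour powers.\<close>

fun raw_power ::
  "real \<Rightarrow> real \<Rightarrow> ('w, 'p, 'c::finite) traffic \<Rightarrow> ('w \<Rightarrow> 'p \<Rightarrow> 'i)
    \<Rightarrow> power_kind \<Rightarrow> 'i \<Rightarrow> nat \<Rightarrow> 'w \<Rightarrow> nat \<Rightarrow> real" where
  "raw_power g t0 (Timetable N R) area q i h \<omega> k =
    1 / dt_ID * (\<Sum>r<N \<omega>. run_bin g t0 (area \<omega>) q i h k (R \<omega> r))"
| "raw_power g t0 (Confirmed hs n rep arr dep) area q i h \<omega> k =
    1 / dt_ID * (\<Sum>c\<in>UNIV. \<Sum>l\<in>hs. \<Sum>j<n \<omega> c l.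
      run_bin g t0 (area \<omega>) q i h k (template_run t0 c l (rep \<omega> c) (arr \<omega> c j) (dep \<omega> c j)))"


subsection \<open>Normalization, concentration and projection\<close>

definition norm_weight :: "(nat \<Rightarrow> real) \<Rightarrow> nat \<Rightarrow> real" where
  "norm_weight p k = (if 0 < (\<Sum>j<nu. p j) then p k / (\<Sum>j<nu. p j) else 1 / real nu)"

definition conc_weight :: "real \<Rightarrow> (nat \<Rightarrow> real) \<Rightarrow> nat \<Rightarrow> real" where
  "conc_weight c p k = (1 - c) / real nu + c * norm_weight p k"

definition conc_profile :: "real \<Rightarrow> real \<Rightarrow> (nat \<Rightarrow> real) \<Rightarrow> nat \<Rightarrow> real" where
  "conc_profile c target p k = real nu * target * conc_weight c p k"

definition proj_objective ::
  "(nat \<Rightarrow> real) \<Rightarrow> real \<Rightarrow> (nat \<Rightarrow> real) \<Rightarrow> (nat \<Rightarrow> real) \<Rightarrow> real" where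
  "proj_objective a \<sigma> p x =
    (\<Sum>k<nu. a k * (x k - p k)\<^sup>2) + \<sigma> * (\<Sum>k<nu - 1. (x (Suc k) - x k)\<^sup>2)"

text \<open>Quarter-hour vectors are functions that are \<open>undefined\<close> outside \<open>{..<nu}\<close>.\<close>

definition proj_feasible :: "real \<Rightarrow> (nat \<Rightarrow> real) set" where
  "proj_feasible target =
    {x \<in> {..<nu} \<rightarrow>\<^sub>E {0..}. 1 / real nu * (\<Sum>k<nu. x k) = target}"

definition is_projection ::
  "(nat \<Rightarrow> real) \<Rightarrow> real \<Rightarrow> real \<Rightarrow> (nat \<Rightarrow> real) \<Rightarrow> (nat \<Rightarrow> real) \<Rightarrow> bool" where
  "is_projection a \<sigma> target p x \<longleftrightarrow>
    x \<in> proj_feasible target \<and>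
    (\<forall>y\<in>proj_feasible target. proj_objective a \<sigma> p x \<le> proj_objective a \<sigma> p y)"

definition proj_profile ::
  "(nat \<Rightarrow> real) \<Rightarrow> real \<Rightarrow> real \<Rightarrow> (nat \<Rightarrow> real) \<Rightarrow> nat \<Rightarrow> real" where
  "proj_profile a \<sigma> target p = (THE x. is_projection a \<sigma> target p x)"


text \<open>The projection is well defined for every nonnegative target.\<close>

lemma proj_objective_midpoint:
  assumes a: "\<And>k. k < nu \<Longrightarrow> 0 < a k" and s: "0 \<le> \<sigma>"
  shows "proj_objective a \<sigma> p (\<lambda>k\<in>{..<nu}. (x k + y k) / 2) + (\<Sum>k<nu. a k * (x k - y k)\<^sup>2) / 4
    \<le> (proj_objective a \<sigma> p x + proj_objective a \<sigma> p y) / 2"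
proof -
  let ?z = "\<lambda>k\<in>{..<nu}. (x k + y k) / 2"
  have 1: "(\<Sum>k<nu. a k * (?z k - p k)\<^sup>2) + (\<Sum>k<nu. a k * (x k - y k)\<^sup>2) / 4
      = ((\<Sum>k<nu. a k * (x k - p k)\<^sup>2) + (\<Sum>k<nu. a k * (y k - p k)\<^sup>2)) / 2"
    unfolding sum_divide_distrib sum.distrib[symmetric]
    by (rule sum.cong) (auto simp: power2_eq_square field_simps)
  have 2: "(\<Sum>k<nu - 1. (?z (Suc k) - ?z k)\<^sup>2)
      \<le> ((\<Sum>k<nu - 1. (x (Suc k) - x k)\<^sup>2) + (\<Sum>k<nu - 1. (y (Suc k) - y k)\<^sup>2)) / 2"
    unfolding sum_divide_distrib sum.distrib[symmetric]
  proof (rule sum_mono)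
    fix k assume "k \<in> {..<nu - 1}"
    then have k: "k < nu" "Suc k < nu" by auto
    have e: "((u + v) / 2)\<^sup>2 \<le> (u\<^sup>2 + v\<^sup>2) / 2" for u v :: real
      using zero_le_power2[of "u - v"] by (simp add: power2_eq_square field_simps)
    have "?z (Suc k) - ?z k = ((x (Suc k) - x k) + (y (Suc k) - y k)) / 2"
      using k by (simp add: field_simps)
    then show "(?z (Suc k) - ?z k)\<^sup>2 \<le> ((x (Suc k) - x k)\<^sup>2 + (y (Suc k) - y k)\<^sup>2) / 2"
      using e by presburger
  qed
  show ?thesis
    using 1 mult_left_mono[OF 2 s] unfolding proj_objective_def by (simp add: field_simps)
qed

lemma ex1_projection:
  assumes a: "\<And>k. k < nu \<Longrightarrow> 0 < a k" and s: "0 \<le> \<sigma>" and t: "0 \<le> target"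
  shows "\<exists>!x. is_projection a \<sigma> target p x"
proof -
  have nu: "0 < nu" by (simp add: nu_def)
  have mean: "1 / real nu * m = target \<longleftrightarrow> m = real nu * target" for m
    using nu by (auto simp: field_simps)
  define B where "B = (\<lambda>k. if k < nu then {0..real nu * target} else {undefined :: real})"
  have bound: "x k \<le> real nu * target" if "x \<in> proj_feasible target" "k < nu" for x k
  proof -
    have "x k \<le> (\<Sum>k<nu. x k)"
      using that by (intro member_le_sum) (auto simp: proj_feasible_def PiE_iff)
    then show ?thesis using that mean by (simp add: proj_feasible_def)
  qed
  have eq: "proj_feasible target = PiE UNIV B \<inter> {x. (\<Sum>k<nu. x k) = real nu * target}"
  proof (intro equalityI subsetI)
    fix x assume x: "x \<in> proj_feasible target"
    then have "x \<in> PiE UNIV B"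
      using bound[OF x] by (auto simp: proj_feasible_def B_def PiE_iff extensional_def)
    then show "x \<in> PiE UNIV B \<inter> {x. (\<Sum>k<nu. x k) = real nu * target}"
      using x mean by (simp add: proj_feasible_def)
  next
    fix x assume "x \<in> PiE UNIV B \<inter> {x. (\<Sum>k<nu. x k) = real nu * target}"
    then show "x \<in> proj_feasible target"
      using mean
      by (auto simp: proj_feasible_def B_def PiE_iff extensional_def split: if_splits)
  qed
  have coord: "continuous_on UNIV (\<lambda>x :: nat \<Rightarrow> real. x k)" for k
    by (rule continuous_on_product_coordinates)
  have "compactin (product_topology (\<lambda>k. euclidean) UNIV) (PiE UNIV B)"
    by (subst compactin_PiE) (auto simp: B_def)
  then have "compact (PiE UNIV B)"
    by (simp add: euclidean_product_topology)
  moreover have "closed {x :: nat \<Rightarrow> real. (\<Sum>k<nu. x k) = real nu * target}"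
    by (intro closed_Collect_eq continuous_intros coord)
  ultimately have comp: "compact (proj_feasible target)"
    unfolding eq by (rule compact_Int_closed)
  have "(\<lambda>k\<in>{..<nu}. target) \<in> proj_feasible target"
    using t nu by (simp add: proj_feasible_def)
  then have ne: "proj_feasible target \<noteq> {}" by blast
  have "continuous_on UNIV (proj_objective a \<sigma> p)"
    unfolding proj_objective_def by (intro continuous_intros coord)
  then have "continuous_on (proj_feasible target) (proj_objective a \<sigma> p)"
    by (rule continuous_on_subset) simp
  from continuous_attains_inf[OF comp ne this]
  obtain x where x: "is_projection a \<sigma> target p x"
    by (auto simp: is_projection_def)
  have uniq: "y = x" if y: "is_projection a \<sigma> target p y" for y
  proof -
    let ?z = "\<lambda>k\<in>{..<nu}. (x k + y k) / 2"
    have fx: "x \<in> proj_feasible target" and fy: "y \<in> proj_feasible target"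
      using x y by (auto simp: is_projection_def)
    have "(\<Sum>k<nu. ?z k) = ((\<Sum>k<nu. x k) + (\<Sum>k<nu. y k)) / 2"
      unfolding sum_divide_distrib sum.distrib[symmetric] by (rule sum.cong) auto
    then have "?z \<in> proj_feasible target"
      using fx fy mean by (auto simp: proj_feasible_def PiE_iff)
    then have "proj_objective a \<sigma> p x \<le> proj_objective a \<sigma> p ?z"
      and "proj_objective a \<sigma> p y \<le> proj_objective a \<sigma> p ?z"
      using x y by (auto simp: is_projection_def)
    then have le: "(\<Sum>k<nu. a k * (x k - y k)\<^sup>2) \<le> 0"
      using proj_objective_midpoint[where a = a and p = p and x = x and y = y, OF a s] by simp
    have nonneg: "0 \<le> a k * (x k - y k)\<^sup>2" if "k < nu" for k
      using a[OF that] by simp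
    then have "(\<Sum>k<nu. a k * (x k - y k)\<^sup>2) = 0"
      using le by (intro antisym sum_nonneg) auto
    then have "a k * (x k - y k)\<^sup>2 = 0" if "k < nu" for k
      using nonneg that by (subst (asm) sum_nonneg_eq_0_iff) auto
    then have "y k = x k" if "k < nu" for k
      using a[OF that] that by force
    then show "y = x"
      using fx fy by (intro PiE_ext[of y "{..<nu}" "\<lambda>_. {0..}" x]) (auto simp: proj_feasible_def)
  qed
  show ?thesis using x uniq by blast
qed


subsection \<open>Measurability of the inputs\<close>

text \<open>
  These predicates concern random train runs \<open>R :: 'w \<Rightarrow> ('p, 'c) train_run\<close>.  Sequences are measurable
  if all their members are; data varying along the track or in time must be jointly measurable.
\<close>

definition stops_measurable ::
  "'w measure \<Rightarrow> ('w \<Rightarrow> ('p::topological_space, 'c) train_run) \<Rightarrow> bool" where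
  "stops_measurable F R \<longleftrightarrow>
    (\<lambda>\<omega>. n_stops (R \<omega>)) \<in> measurable F (count_space UNIV) \<and>
    (\<forall>k. (\<lambda>\<omega>. stop_at (R \<omega>) k) \<in> borel_measurable F)"

definition times_measurable ::
  "'w measure \<Rightarrow> ('w \<Rightarrow> ('p::topological_space, 'c) train_run) \<Rightarrow> bool" where
  "times_measurable F R \<longleftrightarrow>
    (\<forall>k. (\<lambda>\<omega>. arrival (R \<omega>) k) \<in> borel_measurable F) \<and>
    (\<forall>k. (\<lambda>\<omega>. departure (R \<omega>) k) \<in> borel_measurable F)"

definition route_measurable ::
  "'w measure \<Rightarrow> ('w \<Rightarrow> ('p::topological_space, 'c) train_run) \<Rightarrow> bool" where
  "route_measurable F R \<longleftrightarrow>
    (\<forall>k. (\<lambda>\<omega>. leg_length (R \<omega>) k) \<in> borel_measurable F) \<and>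
    (\<forall>k. (\<lambda>(\<omega>, s). leg_path (R \<omega>) k s) \<in> borel_measurable (F \<Otimes>\<^sub>M borel)) \<and>
    (\<forall>k. (\<lambda>(\<omega>, s). leg_gradient (R \<omega>) k s) \<in> borel_measurable (F \<Otimes>\<^sub>M borel))"

definition stock_measurable ::
  "'w measure \<Rightarrow> ('w \<Rightarrow> ('p::topological_space, 'c) train_run) \<Rightarrow> bool" where
  "stock_measurable F R \<longleftrightarrow>
    (\<lambda>\<omega>. mass (R \<omega>)) \<in> borel_measurable F \<and>
    (\<lambda>\<omega>. rot_factor (R \<omega>)) \<in> borel_measurable F \<and>
    (\<lambda>\<omega>. res_const (R \<omega>)) \<in> borel_measurable F \<and>
    (\<lambda>\<omega>. res_lin (R \<omega>)) \<in> borel_measurable F \<and>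
    (\<lambda>\<omega>. res_quad (R \<omega>)) \<in> borel_measurable F \<and>
    (\<lambda>\<omega>. accel (R \<omega>)) \<in> borel_measurable F \<and>
    (\<lambda>\<omega>. brake (R \<omega>)) \<in> borel_measurable F \<and>
    (\<lambda>\<omega>. eta_drive (R \<omega>)) \<in> borel_measurable F \<and>
    (\<lambda>\<omega>. eta_regen (R \<omega>)) \<in> borel_measurable F \<and>
    (\<lambda>(\<omega>, t). aux_power (R \<omega>) t) \<in> borel_measurable (F \<Otimes>\<^sub>M borel)"

fun schedule_measurable ::
  "'w measure \<Rightarrow> ('w, 'p::topological_space, 'c) traffic \<Rightarrow> bool" where
  "schedule_measurable F (Timetable N R) \<longleftrightarrow>
    N \<in> measurable F (count_space UNIV) \<and>
    (\<forall>r. stops_measurable F (\<lambda>\<omega>. R \<omega> r) \<and> times_measurable F (\<lambda>\<omega>. R \<omega> r) \<and>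
         (\<lambda>\<omega>. category (R \<omega> r)) \<in> measurable F (count_space UNIV))"
| "schedule_measurable F (Confirmed hs n rep arr dep) \<longleftrightarrow>
    (\<forall>c. \<forall>h\<in>hs. (\<lambda>\<omega>. n \<omega> c h) \<in> measurable F (count_space UNIV)) \<and>
    (\<forall>c. stops_measurable F (\<lambda>\<omega>. rep \<omega> c)) \<and>
    (\<forall>c j k. (\<lambda>\<omega>. arr \<omega> c j k) \<in> borel_measurable F) \<and>
    (\<forall>c j k. (\<lambda>\<omega>. dep \<omega> c j k) \<in> borel_measurable F)"

fun parameters_measurable ::
  "'w measure \<Rightarrow> ('w, 'p::topological_space, 'c) traffic \<Rightarrow> bool" where
  "parameters_measurable F (Timetable N R) \<longleftrightarrow>
    (\<forall>r. route_measurable F (\<lambda>\<omega>. R \<omega> r) \<and> stock_measurable F (\<lambda>\<omega>. R \<omega> r))"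
| "parameters_measurable F (Confirmed hs n rep arr dep) \<longleftrightarrow>
    (\<forall>c. route_measurable F (\<lambda>\<omega>. rep \<omega> c) \<and> stock_measurable F (\<lambda>\<omega>. rep \<omega> c))"

definition areas_measurable ::
  "'w measure \<Rightarrow> ('w \<Rightarrow> 'p::topological_space \<Rightarrow> 'i) \<Rightarrow> bool" where
  "areas_measurable F area \<longleftrightarrow>
    (\<lambda>(\<omega>, x). area \<omega> x) \<in> measurable (F \<Otimes>\<^sub>M borel) (count_space UNIV)"

fun traffic_wf :: "'w set \<Rightarrow> ('w, 'p, 'c) traffic \<Rightarrow> bool" where
  "traffic_wf W (Timetable N R) \<longleftrightarrow> (\<forall>\<omega>\<in>W. \<forall>r<N \<omega>. run_wf (R \<omega> r))"
| "traffic_wf W (Confirmed hs n rep arr dep) \<longleftrightarrow>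
    finite hs \<and> (\<forall>\<omega>\<in>W. \<forall>c. run_wf (rep \<omega> c))"

end

theory Submission
  imports Defs
begin

text \<open>
  A profile at one outcome depends on the data at that outcome only, so the point is that every
  operation of the synthesis is a measurable function of its inputs.  Three of them are not plain
  arithmetic and case distinction.

  The state of a train depends on the time as well as on the outcome, and its travelled distance and
  its power are integrated over time.  All quantities of a run are therefore shown to be jointly
  measurable in outcome and time, after which Fubini's theorem makes each integral a measurable
  function of the outcome (\<open>borel_measurable_run_bin\<close>).  Instead of carrying product spaces along,
  the intermediate lemmas evaluate a random run on an arbitrary measurable space \<open>N\<close> at a random
  time \<open>u\<close>: joint measurability is the instance in which \<open>N\<close> is a product and \<open>u\<close> its second
  projection, because measurability of the data of a run survives a measurable change of the sample
  space (\<open>run_measurable_compose\<close>).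

  The current leg and the number of runs are random natural numbers that serve as indices.  They
  take countably many values, so a family that is measurable for each fixed index stays measurable
  when a random index is substituted.

  The projection is a minimizer, and no formula for it is at hand.  Its objective is strongly convex:
  the squared distance of a feasible point to the minimizer is bounded by the excess of the
  objective there (\<open>projection_gap\<close>).  The feasible points of a target \<open>T \<ge> 0\<close> are the \<open>T\<close>-multiples
  of those of target 1, and countably many of the latter are dense.  The first multiple of these
  whose objective is within \<open>1 / (i + 1)\<close> of the infimum is a measurable function of the data, and by
  the bound it converges to the projection as \<open>i\<close> grows (\<open>borel_measurable_proj_profile\<close>).  For a
  negative target nothing is feasible, and the profile is a fixed default value.
\<close>

section \<open>Random train runs\<close>

definition run_measurable ::
  "'w measure \<Rightarrow> ('w \<Rightarrow> ('p::topological_space, 'c) train_run) \<Rightarrow> bool" where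
  "run_measurable N R \<longleftrightarrow>
    stops_measurable N R \<and> times_measurable N R \<and> route_measurable N R \<and> stock_measurable N R"

text \<open>
  With \<open>f\<close> the first projection of a product, a run becomes a random run on pairs of an outcome and
  a time, which is what the integrals over time require.
\<close>

lemma run_measurable_compose:
  assumes f [measurable]: "f \<in> measurable N F" and R: "run_measurable F R"
  shows "run_measurable N (\<lambda>x. R (f x))"
proof -
  have joint: "(\<lambda>(x, s). h (f x) s) \<in> measurable (N \<Otimes>\<^sub>M borel) L"
    if "(\<lambda>(\<omega>, s). h \<omega> s) \<in> measurable (F \<Otimes>\<^sub>M borel) L" for h :: "_ \<Rightarrow> real \<Rightarrow> _" and L
  proof -
    have "(\<lambda>(x, s). (f x, s)) \<in> measurable (N \<Otimes>\<^sub>M borel) (F \<Otimes>\<^sub>M (borel :: real measure))"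
      by measurable
    from measurable_compose[OF this that] show ?thesis
      by (simp add: case_prod_beta')
  qed
  show ?thesis
    using R
    unfolding run_measurable_def stops_measurable_def times_measurable_def route_measurable_def
      stock_measurable_def
    by (auto intro!: joint intro: measurable_compose[OF f])
qed

text \<open>
  \<open>GREATEST\<close> is a definite description, so its value is one fixed number on the whole event that no
  greatest index exists.
\<close>

lemma measurable_Greatest_nat:
  fixes P :: "nat \<Rightarrow> 'a \<Rightarrow> bool"
  assumes [measurable]: "\<And>i. Measurable.pred N (P i)"
  shows "(\<lambda>x. GREATEST i. P i x) \<in> measurable N (count_space UNIV)"
proof -
  define Q where "Q k x \<longleftrightarrow> P k x \<and> (\<forall>i. P i x \<longrightarrow> i \<le> k)" for k x
  have [measurable]: "Measurable.pred N (Q k)" for k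
    unfolding Q_def by measurable
  have "(GREATEST i. P i x) = (if \<exists>k. Q k x then LEAST k. Q k x else THE k. False)" for x
  proof (cases "\<exists>k. Q k x")
    case True
    then obtain k where k: "Q k x" by blast
    then have "(GREATEST i. P i x) = k"
      by (intro Greatest_equality) (auto simp: Q_def)
    moreover have "(LEAST k. Q k x) = k"
      using k by (intro Least_equality) (auto simp: Q_def)
    ultimately show ?thesis using True by simp
  next
    case False
    have "(GREATEST i. P i x) = (THE k. Q k x)"
      unfolding Greatest_def Q_def ..
    with False show ?thesis by simp
  qed
  then show ?thesis by simp
qed

context
  fixes N :: "'a measure" and R :: "'a \<Rightarrow> ('p::topological_space, 'c) train_run"
  assumes run: "run_measurable N R"
begin

lemma measurable_run_data [measurable]:
  shows "(\<lambda>x. n_stops (R x)) \<in> measurable N (count_space UNIV)"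
    and "(\<lambda>x. stop_at (R x) k) \<in> borel_measurable N"
    and "(\<lambda>x. arrival (R x) k) \<in> borel_measurable N"
    and "(\<lambda>x. departure (R x) k) \<in> borel_measurable N"
    and "(\<lambda>x. leg_length (R x) k) \<in> borel_measurable N"
    and "(\<lambda>x. mass (R x)) \<in> borel_measurable N"
    and "(\<lambda>x. rot_factor (R x)) \<in> borel_measurable N"
    and "(\<lambda>x. res_const (R x)) \<in> borel_measurable N"
    and "(\<lambda>x. res_lin (R x)) \<in> borel_measurable N"
    and "(\<lambda>x. res_quad (R x)) \<in> borel_measurable N"
    and "(\<lambda>x. accel (R x)) \<in> borel_measurable N"
    and "(\<lambda>x. brake (R x)) \<in> borel_measurable N"
    and "(\<lambda>x. eta_drive (R x)) \<in> borel_measurable N"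
    and "(\<lambda>x. eta_regen (R x)) \<in> borel_measurable N"
  using run
  by (auto simp: run_measurable_def stops_measurable_def times_measurable_def route_measurable_def
      stock_measurable_def)

lemma measurable_run_functions:
  assumes s [measurable]: "s \<in> borel_measurable N"
  shows "(\<lambda>x. leg_path (R x) k (s x)) \<in> borel_measurable N"
    and "(\<lambda>x. leg_gradient (R x) k (s x)) \<in> borel_measurable N"
    and "(\<lambda>x. aux_power (R x) (s x)) \<in> borel_measurable N"
proof -
  have diag: "(\<lambda>x. (x, s x)) \<in> measurable N (N \<Otimes>\<^sub>M borel)"
    by measurable
  have eval: "(\<lambda>x. h x (s x)) \<in> borel_measurable N"
    if "(\<lambda>(x, s). h x s) \<in> borel_measurable (N \<Otimes>\<^sub>M borel)"
    for h :: "'a \<Rightarrow> real \<Rightarrow> 'b::topological_space"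
    using measurable_compose[OF diag that] by simp
  show "(\<lambda>x. leg_path (R x) k (s x)) \<in> borel_measurable N"
    "(\<lambda>x. leg_gradient (R x) k (s x)) \<in> borel_measurable N"
    "(\<lambda>x. aux_power (R x) (s x)) \<in> borel_measurable N"
    using run
    by (auto simp: run_measurable_def route_measurable_def stock_measurable_def intro!: eval)
qed

lemma measurable_n_legs [measurable]: "(\<lambda>x. n_legs (R x)) \<in> measurable N (count_space UNIV)"
  unfolding n_legs_def by measurable

lemma borel_measurable_kappa_v [measurable]: "(\<lambda>x. kappa_v (R x)) \<in> borel_measurable N"
  unfolding kappa_v_def by measurable

lemma borel_measurable_booked_time [measurable]: "(\<lambda>x. booked_time (R x) k) \<in> borel_measurable N"
  unfolding booked_time_def by measurable

lemma pred_trapezoidal [measurable]: "Measurable.pred N (\<lambda>x. trapezoidal (R x) k)"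
  unfolding trapezoidal_def by measurable

lemma borel_measurable_top_speed [measurable]: "(\<lambda>x. top_speed (R x) k) \<in> borel_measurable N"
  unfolding top_speed_def by measurable

lemma borel_measurable_running_time [measurable]:
  "(\<lambda>x. running_time (R x) k) \<in> borel_measurable N"
  unfolding running_time_def by measurable

lemma borel_measurable_leg_start [measurable]: "(\<lambda>x. leg_start (R x) k) \<in> borel_measurable N"
  by (induction k) auto

lemma borel_measurable_leg_speed:
  assumes [measurable]: "u \<in> borel_measurable N"
  shows "(\<lambda>x. leg_speed (R x) k (u x)) \<in> borel_measurable N"
  unfolding leg_speed_def by measurable

lemma borel_measurable_leg_accel:
  assumes [measurable]: "u \<in> borel_measurable N"
  shows "(\<lambda>x. leg_accel (R x) k (u x)) \<in> borel_measurable N"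
  unfolding leg_accel_def by measurable

end

lemma borel_measurable_leg_distance:
  fixes R :: "'a \<Rightarrow> ('p::topological_space, 'c) train_run"
  assumes R: "run_measurable N R" and u [measurable]: "u \<in> borel_measurable N"
  shows "(\<lambda>x. leg_distance (R x) k (u x)) \<in> borel_measurable N"
proof -
  have "run_measurable (N \<Otimes>\<^sub>M lborel) (\<lambda>y. R (fst y))"
    using R by (rule run_measurable_compose[rotated]) simp
  then have [measurable]:
    "(\<lambda>y. leg_speed (R (fst y)) k (snd y)) \<in> borel_measurable (N \<Otimes>\<^sub>M lborel)"
    by (rule borel_measurable_leg_speed) simp
  \<comment> \<open>The integration domain varies with \<open>x\<close>, so it has to enter as a jointly measurable condition.\<close>
  have "Measurable.pred (N \<Otimes>\<^sub>M lborel) (\<lambda>y. 0 \<le> snd y \<and> snd y \<le> u (fst y))"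
    by measurable
  then have "(\<lambda>y. if 0 \<le> snd y \<and> snd y \<le> u (fst y) then leg_speed (R (fst y)) k (snd y) else 0)
      \<in> borel_measurable (N \<Otimes>\<^sub>M lborel)"
    by measurable
  also have "(\<lambda>y. if 0 \<le> snd y \<and> snd y \<le> u (fst y) then leg_speed (R (fst y)) k (snd y) else 0)
      = (\<lambda>(x, t). indicator {0..u x} t *\<^sub>R leg_speed (R x) k t)"
    by (auto simp: indicator_def fun_eq_iff)
  finally show ?thesis
    unfolding leg_distance_def set_lebesgue_integral_def
    by (rule lborel.borel_measurable_lebesgue_integral)
qed


section \<open>State and power at a random time\<close>

context
  fixes N :: "'a measure" and R :: "'a \<Rightarrow> ('p::topological_space, 'c) train_run"
    and u :: "'a \<Rightarrow> real"
  assumes run: "run_measurable N R" and time [measurable]: "u \<in> borel_measurable N"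
begin

lemmas [measurable] =
  measurable_run_data [OF run] measurable_n_legs [OF run]
  borel_measurable_leg_start [OF run] borel_measurable_running_time [OF run]

lemma pred_in_service: "Measurable.pred N (\<lambda>x. in_service (R x) (u x))"
proof -
  note at_n_legs = measurable_compose_countable [OF _ measurable_n_legs [OF run]]
  have [measurable]: "(\<lambda>x. leg_start (R x) (n_legs (R x) - 1)) \<in> borel_measurable N"
    by (rule at_n_legs [where f = "\<lambda>k x. leg_start (R x) (k - 1)"])
      (rule borel_measurable_leg_start [OF run])
  have [measurable]: "(\<lambda>x. running_time (R x) (n_legs (R x) - 1)) \<in> borel_measurable N"
    by (rule at_n_legs [where f = "\<lambda>k x. running_time (R x) (k - 1)"])
      (rule borel_measurable_running_time [OF run])
  show ?thesis unfolding in_service_def by measurable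
qed

lemma measurable_current_leg [measurable]:
  "(\<lambda>x. current_leg (R x) (u x)) \<in> measurable N (count_space UNIV)"
  unfolding current_leg_def by (rule measurable_Greatest_nat) measurable

text \<open>The current leg has countably many values, so measurability for each fixed leg suffices.\<close>

lemma measurable_at_current_leg:
  assumes "\<And>k. f k \<in> measurable N L"
  shows "(\<lambda>x. f (current_leg (R x) (u x)) x) \<in> measurable N L"
  using assms measurable_current_leg by (rule measurable_compose_countable)

lemma borel_measurable_leg_time [measurable]: "(\<lambda>x. leg_time (R x) (u x)) \<in> borel_measurable N"
  unfolding leg_time_def
  by (intro borel_measurable_diff time
      measurable_at_current_leg [where f = "\<lambda>k x. leg_start (R x) k"]
      borel_measurable_leg_start [OF run])

lemma borel_measurable_speed [measurable]: "(\<lambda>x. speed (R x) (u x)) \<in> borel_measurable N"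
  unfolding speed_def
  by (rule measurable_at_current_leg [where f = "\<lambda>k x. leg_speed (R x) k (leg_time (R x) (u x))"])
    (rule borel_measurable_leg_speed [OF run borel_measurable_leg_time])

lemma borel_measurable_acceleration [measurable]:
  "(\<lambda>x. acceleration (R x) (u x)) \<in> borel_measurable N"
  unfolding acceleration_def
  by (rule measurable_at_current_leg [where f = "\<lambda>k x. leg_accel (R x) k (leg_time (R x) (u x))"])
    (rule borel_measurable_leg_accel [OF run borel_measurable_leg_time])

lemma borel_measurable_current_distance:
  "(\<lambda>x. leg_distance (R x) k (leg_time (R x) (u x))) \<in> borel_measurable N"
  by (rule borel_measurable_leg_distance [OF run borel_measurable_leg_time])

lemma borel_measurable_gradient [measurable]: "(\<lambda>x. gradient (R x) (u x)) \<in> borel_measurable N"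
  unfolding gradient_def
  by (rule measurable_at_current_leg
      [where f = "\<lambda>k x. leg_gradient (R x) k (leg_distance (R x) k (leg_time (R x) (u x)))"])
    (rule measurable_run_functions [OF run borel_measurable_current_distance])

lemma borel_measurable_position: "(\<lambda>x. position (R x) (u x)) \<in> borel_measurable N"
proof -
  have "(\<lambda>x. if leg_time (R x) (u x) < running_time (R x) k
          then leg_path (R x) k (leg_distance (R x) k (leg_time (R x) (u x)))
          else stop_at (R x) (Suc k)) \<in> borel_measurable N" for k
  proof -
    have [measurable]:
      "(\<lambda>x. leg_path (R x) k (leg_distance (R x) k (leg_time (R x) (u x)))) \<in> borel_measurable N"
      by (rule measurable_run_functions [OF run borel_measurable_current_distance])
    show ?thesis by measurable
  qed
  from measurable_at_current_leg [OF this] show ?thesis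
    unfolding position_def .
qed

lemma borel_measurable_mech_power [measurable]:
  "(\<lambda>x. mech_power g (R x) (u x)) \<in> borel_measurable N"
  unfolding mech_power_def traction_def by measurable

lemma borel_measurable_el_power [measurable]:
  "(\<lambda>x. el_power g (R x) (u x)) \<in> borel_measurable N"
proof -
  note [measurable] = measurable_run_functions(3) [OF run time]
  show ?thesis unfolding el_power_def by measurable
qed

lemma borel_measurable_power: "(\<lambda>x. power g q (R x) (u x)) \<in> borel_measurable N"
  by (cases q) simp_all

end


section \<open>Quarter-hour powers\<close>

lemma borel_measurable_run_bin:
  fixes R :: "'w \<Rightarrow> ('p::topological_space, 'c) train_run" and area :: "'w \<Rightarrow> 'p \<Rightarrow> 'i"
  assumes R: "run_measurable F R" and area: "areas_measurable F area"
  shows "(\<lambda>\<omega>. run_bin g t0 (area \<omega>) q i h k (R \<omega>)) \<in> borel_measurable F"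
proof -
  let ?N = "F \<Otimes>\<^sub>M (lborel :: real measure)"
  have run: "run_measurable ?N (\<lambda>y. R (fst y))"
    using R by (rule run_measurable_compose[rotated]) simp
  have time: "snd \<in> borel_measurable ?N" by simp
  note [measurable] = borel_measurable_power [OF run time, of g q] pred_in_service [OF run time]
    borel_measurable_position [OF run time]
  have "(\<lambda>y. (fst y, position (R (fst y)) (snd y))) \<in> measurable ?N (F \<Otimes>\<^sub>M borel)"
    by measurable
  from measurable_compose [OF this area [unfolded areas_measurable_def]]
  have "(\<lambda>y. area (fst y) (position (R (fst y)) (snd y))) \<in> measurable ?N (count_space UNIV)"
    by simp
  then have [measurable]:
    "Measurable.pred ?N (\<lambda>y. area (fst y) (position (R (fst y)) (snd y)) = i)"
    by (rule measurable_compose) simp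
  have [measurable]: "bin t0 h k \<in> sets lborel"
    by (simp add: bin_def)
  have "(\<lambda>y. indicator (bin t0 h k) (snd y) *\<^sub>R
        (if in_service (R (fst y)) (snd y) \<and> area (fst y) (position (R (fst y)) (snd y)) = i
         then power g q (R (fst y)) (snd y) else 0)) \<in> borel_measurable ?N"
    by measurable
  then show ?thesis
    unfolding run_bin_def set_lebesgue_integral_def
    by (intro lborel.borel_measurable_lebesgue_integral) (simp add: case_prod_beta')
qed

text \<open>A template run inherits everything but its times from the representative of its category.\<close>

lemma run_measurable_template_run:
  assumes "stops_measurable F R" "route_measurable F R" "stock_measurable F R"
    and [measurable]: "\<And>k. (\<lambda>\<omega>. arr \<omega> k) \<in> borel_measurable F"
      "\<And>k. (\<lambda>\<omega>. dep \<omega> k) \<in> borel_measurable F"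
  shows "run_measurable F (\<lambda>\<omega>. template_run t0 c h (R \<omega>) (arr \<omega>) (dep \<omega>))"
proof -
  let ?R = "\<lambda>\<omega>. template_run t0 c h (R \<omega>) (arr \<omega>) (dep \<omega>)"
  have "stops_measurable F ?R" "route_measurable F ?R" "stock_measurable F ?R"
    using assms(1-3)
    unfolding stops_measurable_def route_measurable_def stock_measurable_def template_run_def
    by simp_all
  moreover have "times_measurable F ?R"
    unfolding times_measurable_def template_run_def by simp
  ultimately show ?thesis unfolding run_measurable_def by blast
qed

lemma borel_measurable_random_sum:
  fixes f :: "'w \<Rightarrow> nat \<Rightarrow> real"
  assumes [measurable]: "\<And>j. (\<lambda>\<omega>. f \<omega> j) \<in> borel_measurable F"
    and n: "n \<in> measurable F (count_space UNIV)"
  shows "(\<lambda>\<omega>. \<Sum>j<n \<omega>. f \<omega> j) \<in> borel_measurable F"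
  using _ n by (rule measurable_compose_countable [where f = "\<lambda>m \<omega>. \<Sum>j<m. f \<omega> j"]) measurable

lemma borel_measurable_raw_power:
  fixes S :: "('w, 'p::topological_space, 'c::finite) traffic"
  assumes "schedule_measurable F S" "parameters_measurable F S"
    and area: "areas_measurable F area"
  shows "(\<lambda>\<omega>. raw_power g t0 S area q i h \<omega> k) \<in> borel_measurable F"
proof (cases S)
  case (Timetable N R)
  then have "run_measurable F (\<lambda>\<omega>. R \<omega> r)" for r
    using assms by (simp add: run_measurable_def)
  then have "(\<lambda>\<omega>. \<Sum>r<N \<omega>. run_bin g t0 (area \<omega>) q i h k (R \<omega> r)) \<in> borel_measurable F"
    using assms(1) Timetable
    by (intro borel_measurable_random_sum borel_measurable_run_bin area) simp_all
  then show ?thesis using Timetable by simp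
next
  case (Confirmed hs n rep arr dep)
  then have "run_measurable F (\<lambda>\<omega>. template_run t0 c l (rep \<omega> c) (arr \<omega> c j) (dep \<omega> c j))" for c l j
    using assms by (intro run_measurable_template_run) simp_all
  then have "(\<lambda>\<omega>. \<Sum>c\<in>UNIV. \<Sum>l\<in>hs. \<Sum>j<n \<omega> c l.
      run_bin g t0 (area \<omega>) q i h k (template_run t0 c l (rep \<omega> c) (arr \<omega> c j) (dep \<omega> c j)))
      \<in> borel_measurable F"
    using assms(1) Confirmed
    by (intro borel_measurable_sum borel_measurable_random_sum borel_measurable_run_bin area)
      simp_all
  then show ?thesis using Confirmed by simp
qed


section \<open>Concentration and projection\<close>

lemma borel_measurable_conc_profile:
  assumes [measurable]: "T \<in> borel_measurable F" "\<And>k. (\<lambda>\<omega>. p \<omega> k) \<in> borel_measurable F"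
  shows "(\<lambda>\<omega>. conc_profile c (T \<omega>) (p \<omega>) k) \<in> borel_measurable F"
  unfolding conc_profile_def conc_weight_def norm_weight_def by measurable

lemma proj_objective_cong:
  assumes "\<And>k. k < nu \<Longrightarrow> x k = y k"
  shows "proj_objective a \<sigma> p x = proj_objective a \<sigma> p y"
  unfolding proj_objective_def using assms
  by (intro arg_cong2 [where f = "(+)"] arg_cong2 [where f = "(*)"] sum.cong refl) auto

lemma proj_feasible_iff:
  "x \<in> proj_feasible T \<longleftrightarrow>
    (\<forall>k<nu. 0 \<le> x k) \<and> x \<in> extensional {..<nu} \<and> (\<Sum>k<nu. x k) = real nu * T"
proof -
  have "1 / real nu * m = T \<longleftrightarrow> m = real nu * T" for m
    by (auto simp: nu_def)
  then show ?thesis unfolding proj_feasible_def PiE_iff by auto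
qed

text \<open>
  The midpoint of the two points is feasible, so its objective is at least that of the minimizer
  \<open>x\<close>; strong convexity of the objective then leaves no room for a distant \<open>y\<close> of similar value.
\<close>

lemma projection_gap:
  assumes a: "\<And>k. k < nu \<Longrightarrow> 0 < a k" and s: "0 \<le> \<sigma>"
    and x: "is_projection a \<sigma> T p x" and y: "y \<in> proj_feasible T"
  shows "(\<Sum>k<nu. a k * (x k - y k)\<^sup>2) \<le> 2 * (proj_objective a \<sigma> p y - proj_objective a \<sigma> p x)"
proof -
  let ?z = "\<lambda>k\<in>{..<nu}. (x k + y k) / 2"
  have fx: "x \<in> proj_feasible T" using x by (simp add: is_projection_def)
  have "(\<Sum>k<nu. ?z k) = ((\<Sum>k<nu. x k) + (\<Sum>k<nu. y k)) / 2"
    unfolding sum_divide_distrib sum.distrib[symmetric] by (rule sum.cong) auto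
  also have "\<dots> = real nu * T"
    using fx y by (simp add: proj_feasible_iff)
  finally have "?z \<in> proj_feasible T"
    using fx y unfolding proj_feasible_iff by simp
  then have "proj_objective a \<sigma> p x \<le> proj_objective a \<sigma> p ?z"
    using x by (simp add: is_projection_def)
  then show ?thesis
    using proj_objective_midpoint [where a = a and p = p and x = x and y = y, OF a s]
    by (simp add: field_simps)
qed

lemma proj_feasible_nonneg_target:
  assumes "x \<in> proj_feasible T"
  shows "0 \<le> T"
proof -
  have "0 \<le> (\<Sum>k<nu. x k)"
    using assms by (intro sum_nonneg) (simp add: proj_feasible_iff)
  also have "\<dots> = real nu * T" using assms by (simp add: proj_feasible_iff)
  finally show ?thesis by (simp add: nu_def)
qed

lemma scaled_feasible:
  assumes "0 \<le> T" "z \<in> proj_feasible 1"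
  shows "(\<lambda>k\<in>{..<nu}. T * z k) \<in> proj_feasible T"
proof -
  have "(\<Sum>k<nu. (\<lambda>k\<in>{..<nu}. T * z k) k) = T * (\<Sum>k<nu. z k)"
    unfolding sum_distrib_left by (rule sum.cong) auto
  then show ?thesis using assms unfolding proj_feasible_iff by simp
qed

lemma feasible_is_scaled:
  assumes x: "x \<in> proj_feasible T"
  obtains z where "z \<in> proj_feasible 1" "\<And>k. k < nu \<Longrightarrow> x k = T * z k"
proof (cases "T = 0")
  case True
  have sum0: "(\<Sum>k<nu. x k) = 0" and nonneg: "\<And>k. k < nu \<Longrightarrow> 0 \<le> x k"
    using x True unfolding proj_feasible_iff by simp_all
  have "x k = 0" if "k < nu" for k
    using sum0 nonneg that sum_nonneg_eq_0_iff [of "{..<nu}" x] by auto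
  \<comment> \<open>Every multiple by 0 is the zero profile, so any unit profile serves.\<close>
  moreover have "(\<lambda>k\<in>{..<nu}. 1) \<in> proj_feasible 1"
    by (simp add: proj_feasible_iff)
  ultimately show thesis using True by (intro that [of "\<lambda>k\<in>{..<nu}. 1"]) simp_all
next
  case False
  then have "0 < T" using proj_feasible_nonneg_target [OF x] by simp
  have "(\<Sum>k<nu. (\<lambda>k\<in>{..<nu}. x k / T) k) = (\<Sum>k<nu. x k) / T"
    unfolding sum_divide_distrib by (rule sum.cong) auto
  then have "(\<lambda>k\<in>{..<nu}. x k / T) \<in> proj_feasible 1"
    using x \<open>0 < T\<close> unfolding proj_feasible_iff by simp
  then show thesis
    using \<open>0 < T\<close> by (intro that [of "\<lambda>k\<in>{..<nu}. x k / T"]) simp_all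
qed

lemma dense_unit_profiles:
  obtains y :: "nat \<Rightarrow> nat \<Rightarrow> real"
  where "\<And>m. y m \<in> proj_feasible 1" "proj_feasible 1 \<subseteq> closure (range y)"
proof -
  obtain D where D: "countable D" "D \<subseteq> proj_feasible 1" "proj_feasible 1 \<subseteq> closure D"
    by (rule separable)
  have "(\<lambda>k\<in>{..<nu}. 1) \<in> proj_feasible 1"
    by (simp add: proj_feasible_iff)
  then have "D \<noteq> {}" using D(3) by auto
  then have "range (from_nat_into D) = D"
    using D(1) by (rule range_from_nat_into)
  then show thesis using that [of "from_nat_into D"] D by auto
qed

text \<open>
  Write \<open>x\<close> as \<open>T\<close> times a unit profile and approximate the latter by the \<open>y m\<close>: the objective is
  continuous, so its values at the \<open>T * y m\<close> come arbitrarily close to its value at \<open>x\<close>.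
\<close>

lemma INF_scaled_le_feasible:
  fixes y :: "nat \<Rightarrow> nat \<Rightarrow> real"
  assumes bdd: "bdd_below (range (\<lambda>m. proj_objective a \<sigma> p (\<lambda>k. T * y m k)))"
    and dense: "proj_feasible 1 \<subseteq> closure (range y)"
    and x: "x \<in> proj_feasible T"
  shows "(INF m. proj_objective a \<sigma> p (\<lambda>k. T * y m k)) \<le> proj_objective a \<sigma> p x"
proof (rule ccontr)
  let ?f = "\<lambda>w. proj_objective a \<sigma> p (\<lambda>k. T * w k)"
  assume "\<not> (INF m. ?f (y m)) \<le> proj_objective a \<sigma> p x"
  moreover obtain w where w: "w \<in> proj_feasible 1" "\<And>k. k < nu \<Longrightarrow> x k = T * w k"
    using feasible_is_scaled [OF x] by blast
  moreover from w(2) have "proj_objective a \<sigma> p x = ?f w"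
    by (rule proj_objective_cong)
  ultimately have "w \<in> {w. ?f w < (INF m. ?f (y m))}" by simp
  moreover have "open {w. ?f w < (INF m. ?f (y m))}"
    unfolding proj_objective_def
    by (intro open_Collect_less continuous_intros continuous_on_product_coordinates)
  moreover have "w \<in> closure (range y)" using w(1) dense by blast
  ultimately have "{w. ?f w < (INF m. ?f (y m))} \<inter> range y \<noteq> {}"
    using open_Int_closure_eq_empty by blast
  then obtain m where "?f (y m) < (INF m. ?f (y m))" by blast
  moreover have "(INF m. ?f (y m)) \<le> ?f (y m)"
    using bdd by (rule cINF_lower) simp
  ultimately show False by simp
qed

lemma proj_objective_nonneg:
  assumes "\<And>k. k < nu \<Longrightarrow> 0 < a k" "0 \<le> \<sigma>"
  shows "0 \<le> proj_objective a \<sigma> p x"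
  unfolding proj_objective_def using assms
  by (intro add_nonneg_nonneg sum_nonneg mult_nonneg_nonneg) (auto simp: less_imp_le)

text \<open>
  \<open>T \<omega> * y (J i \<omega>)\<close> is a nearly optimal profile that is found by a search among countably many
  candidates, hence measurable in \<open>\<omega>\<close>; the projection is the limit of these as \<open>i\<close> grows.
\<close>

lemma borel_measurable_proj_profile:
  assumes a: "\<And>k. k < nu \<Longrightarrow> 0 < a k" and s: "0 \<le> \<sigma>"
    and T [measurable]: "T \<in> borel_measurable F"
    and p [measurable]: "\<And>k. (\<lambda>\<omega>. p \<omega> k) \<in> borel_measurable F"
    and k: "k < nu"
  shows "(\<lambda>\<omega>. proj_profile a \<sigma> (T \<omega>) (p \<omega>) k) \<in> borel_measurable F"
proof -
  obtain y :: "nat \<Rightarrow> nat \<Rightarrow> real"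
    where y: "\<And>m. y m \<in> proj_feasible 1" and dense: "proj_feasible 1 \<subseteq> closure (range y)"
    using dense_unit_profiles by blast
  define f where "f \<omega> m = proj_objective a \<sigma> (p \<omega>) (\<lambda>k. T \<omega> * y m k)" for \<omega> m
  define J where "J i \<omega> = (LEAST m. f \<omega> m < (INF m. f \<omega> m) + 1 / (real i + 1))" for i \<omega>
  have bdd: "bdd_below (range (f \<omega>))" for \<omega>
    using proj_objective_nonneg [OF a s] by (intro bdd_belowI [where m = 0]) (auto simp: f_def)
  have [measurable]: "(\<lambda>\<omega>. f \<omega> m) \<in> borel_measurable F" for m
    unfolding f_def proj_objective_def by measurable
  have [measurable]: "J i \<in> measurable F (count_space UNIV)" for i
    unfolding J_def by measurable
  \<comment> \<open>If the target is negative, there is no projection, and its description has a default value.\<close>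
  have lim: "(\<lambda>i. if 0 \<le> T \<omega> then T \<omega> * y (J i \<omega>) k else (THE x. False) k)
      \<longlonglongrightarrow> proj_profile a \<sigma> (T \<omega>) (p \<omega>) k" for \<omega>
  proof (cases "0 \<le> T \<omega>")
    case False
    then have "\<not> is_projection a \<sigma> (T \<omega>) (p \<omega>) x" for x
      using proj_feasible_nonneg_target by (auto simp: is_projection_def)
    then show ?thesis using False by (simp add: proj_profile_def)
  next
    case True
    define x where "x = proj_profile a \<sigma> (T \<omega>) (p \<omega>)"
    have x: "is_projection a \<sigma> (T \<omega>) (p \<omega>) x"
      unfolding x_def proj_profile_def
      using ex1_projection [where a = a and \<sigma> = \<sigma> and p = "p \<omega>", OF a s True]
      by (rule theI')
    have close: "(T \<omega> * y (J i \<omega>) k - x k)\<^sup>2 \<le> 2 / a k * (1 / (real i + 1))" for i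
    proof -
      let ?z = "\<lambda>k\<in>{..<nu}. T \<omega> * y (J i \<omega>) k"
      have "\<exists>m. f \<omega> m < (INF m. f \<omega> m) + 1 / (real i + 1)"
        using cINF_less_iff [of UNIV "f \<omega>" "(INF m. f \<omega> m) + 1 / (real i + 1)"] bdd by simp
      then have "f \<omega> (J i \<omega>) < (INF m. f \<omega> m) + 1 / (real i + 1)"
        unfolding J_def by (rule LeastI_ex)
      also have "(INF m. f \<omega> m) \<le> proj_objective a \<sigma> (p \<omega>) x"
        using INF_scaled_le_feasible [OF bdd [unfolded f_def] dense] x
        by (simp add: f_def is_projection_def)
      also have "f \<omega> (J i \<omega>) = proj_objective a \<sigma> (p \<omega>) ?z"
        unfolding f_def by (rule proj_objective_cong) simp
      finally have excess:
        "proj_objective a \<sigma> (p \<omega>) ?z - proj_objective a \<sigma> (p \<omega>) x \<le> 1 / (real i + 1)"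
        by simp
      have "a k * (x k - ?z k)\<^sup>2 \<le> (\<Sum>k<nu. a k * (x k - ?z k)\<^sup>2)"
        using k a by (intro member_le_sum) (simp_all add: less_imp_le)
      also have "\<dots> \<le> 2 * (proj_objective a \<sigma> (p \<omega>) ?z - proj_objective a \<sigma> (p \<omega>) x)"
        using a s x scaled_feasible [OF True y] by (rule projection_gap)
      also have "\<dots> \<le> 2 * (1 / (real i + 1))"
        using excess by (intro mult_left_mono) simp_all
      finally have "a k * (x k - ?z k)\<^sup>2 \<le> 2 * (1 / (real i + 1))" .
      then have "(x k - ?z k)\<^sup>2 \<le> 2 * (1 / (real i + 1)) / a k"
        using a [OF k] by (simp only: pos_le_divide_eq mult.commute)
      then show ?thesis
        using k by (simp add: power2_commute mult.commute)
    qed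
    have "(\<lambda>i. 2 / a k * (1 / (real i + 1))) \<longlonglongrightarrow> 2 / a k * 0"
      using LIMSEQ_inverse_real_of_nat
      by (intro tendsto_mult_left) (simp add: inverse_eq_divide add.commute)
    then have bound: "(\<lambda>i. 2 / a k * (1 / (real i + 1))) \<longlonglongrightarrow> 0" by simp
    have "(\<lambda>i. (T \<omega> * y (J i \<omega>) k - x k)\<^sup>2) \<longlonglongrightarrow> 0"
      using close
      by (intro tendsto_sandwich [OF _ _ tendsto_const [of 0] bound] always_eventually allI) simp_all
    then have "(\<lambda>i. T \<omega> * y (J i \<omega>) k - x k) \<longlonglongrightarrow> 0"
      by simp
    then have "(\<lambda>i. T \<omega> * y (J i \<omega>) k) \<longlonglongrightarrow> x k"
      by (simp add: LIM_zero_iff)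
    then show ?thesis using True by (simp add: x_def)
  qed
  have "(\<lambda>\<omega>. if 0 \<le> T \<omega> then T \<omega> * y (J i \<omega>) k else (THE x. False) k) \<in> borel_measurable F" for i
  proof -
    have [measurable]: "(\<lambda>\<omega>. y (J i \<omega>) k) \<in> borel_measurable F"
      by (rule measurable_compose_countable [where f = "\<lambda>m \<omega>. y m k"]) measurable
    show ?thesis by measurable
  qed
  with lim show ?thesis by (rule borel_measurable_LIMSEQ_real)
qed


section \<open>Measurability of the synthesized profiles\<close>

theorem theorem24:
  fixes M :: "'w measure"
    and F :: "real \<Rightarrow> 'w measure"
    and \<tau> :: "nat \<Rightarrow> real"
    and n :: nat
    and S :: "('w, 'p::topological_space, 'c::finite) traffic"
    and area :: "'w \<Rightarrow> 'p \<Rightarrow> 'i"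
    and target :: "'w \<Rightarrow> power_kind \<Rightarrow> 'i \<Rightarrow> nat \<Rightarrow> real"
    and g t0 c \<sigma> :: real
    and a :: "power_kind \<Rightarrow> 'i \<Rightarrow> nat \<Rightarrow> nat \<Rightarrow> real"
  assumes "prob_space M"
    and "subalgebra M (F (\<tau> n))"
    and "traffic_wf (space M) S"
    and "schedule_measurable (F (\<tau> n)) S"
    and "parameters_measurable (F (\<tau> n)) S"
    and "areas_measurable (F (\<tau> n)) area"
    and "\<And>q i h. (\<lambda>\<omega>. target \<omega> q i h) \<in> borel_measurable (F (\<tau> n))"
    and "0 \<le> c" "c \<le> 1"
    and "\<And>q i h k. k < nu \<Longrightarrow> 0 < a q i h k"
    and "0 \<le> \<sigma>"
  shows "\<forall>q i h. \<forall>k<nu.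
      (\<lambda>\<omega>. conc_profile c (target \<omega> q i h) (raw_power g t0 S area q i h \<omega>) k)
        \<in> borel_measurable (F (\<tau> n)) \<and>
      (\<lambda>\<omega>. proj_profile (a q i h) \<sigma> (target \<omega> q i h) (raw_power g t0 S area q i h \<omega>) k)
        \<in> borel_measurable (F (\<tau> n))"
  using assms
  by (auto intro!: borel_measurable_conc_profile borel_measurable_proj_profile
      borel_measurable_raw_power)

end
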